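(* Let $m\ge 2$ be even, $n\ge 1$, let $\mathcal{A}=(a_{i_1\cdots i_m})\in T_{m,n}$ be a symmetric tensor and let $\lambda$ be an H-eigenvalue of $\mathcal{A}$. Then $$\lambda\in\bigcup_{i=1}^n\bigcup_{j=1}^n\left[a_{ii\cdots i}-r_i^+-\sum_{(i_2,\dots,i_m)\ne(i,\dots,i)}(r_i^+-a_{ii_2\cdots i_m}),\ \ a_{jj\cdots j}-r_j^-+\sum_{(j_2,\dots,j_m)\ne(j,\dots,j)}(a_{jj_2\cdots j_m}-r_j^-)\right],$$ where for $i\in[n]$, $r_i^+=\max\{0,\,a_{ij_2\cdots j_m}:(j_2,\dots,j_m)\ne(i,\dots,i)\}$ and $r_i^-=\min\{0,\,a_{ij_2\cdots j_m}:(j_2,\dots,j_m)\ne(i,\dots,i)\}$.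
   Context: $[n]=\{1,\dots,n\}$. $T_{m,n}$ is the set of real $m$th order $n$-dimensional tensors $\mathcal{A}=(a_{i_1\cdots i_m})$, $i_1,\dots,i_m\in[n]$. $\mathcal{A}$ is symmetric if its entries are invariant under any permutation of their indices. Sums over $(i_2,\dots,i_m)$ range over tuples in $[n]^{m-1}$. A real number $\lambda$ is an H-eigenvalue of $\mathcal{A}$ if there is a nonzero real vector $\mathbf{x}\in\mathbb{R}^n$ with $\mathcal{A}\mathbf{x}^{m-1}=\lambda\mathbf{x}^{[m-1]}$, where $(\mathcal{A}\mathbf{x}^{m-1})_i=\sum_{i_2,\dots,i_m=1}^n a_{ii_2\cdots i_m}x_{i_2}\cdots x_{i_m}$ and $\mathbf{x}^{[m-1]}=(x_1^{m-1},\dots,x_n^{m-1})^\top$. An interval $[a,b]$ with $a>b$ is the empty set. *)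

theory Defs
  imports "HOL-Analysis.Analysis" "HOL-Combinatorics.Permutations"
begin

text \<open>
  A real tensor of order \<open>m\<close> and dimension \<open>CARD('n)\<close> is a function on index lists; only its
  values on lists of length \<open>m\<close> are meaningful, so the order is passed as an explicit argument.
\<close>

type_synonym 'n tensor = "'n list \<Rightarrow> real"

definition tuples :: "nat \<Rightarrow> 'n::finite list set" where
  "tuples k = {js. length js = k}"

lemma finite_tuples: "finite (tuples k :: 'n::finite list set)"
  using finite_lists_length_eq[of "UNIV :: 'n set" k] by (simp add: tuples_def)

definition symmetric_tensor :: "nat \<Rightarrow> 'n::finite tensor \<Rightarrow> bool" where
  "symmetric_tensor m A \<longleftrightarrow>
     (\<forall>js\<in>tuples m. \<forall>p. p permutes {..<m} \<longrightarrow> A (permute_list p js) = A js)"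

definition tensor_apply :: "nat \<Rightarrow> 'n::finite tensor \<Rightarrow> real ^ 'n \<Rightarrow> real ^ 'n" where
  "tensor_apply m A x = (\<chi> i. \<Sum>js\<in>tuples (m - 1). A (i # js) * (\<Prod>j\<leftarrow>js. x $ j))"

definition vec_pow :: "real ^ 'n::finite \<Rightarrow> nat \<Rightarrow> real ^ 'n" where
  "vec_pow x k = (\<chi> i. (x $ i) ^ k)"

definition H_eigenvalue :: "nat \<Rightarrow> 'n::finite tensor \<Rightarrow> real \<Rightarrow> bool" where
  "H_eigenvalue m A l \<longleftrightarrow> (\<exists>x. x \<noteq> 0 \<and> tensor_apply m A x = l *\<^sub>R vec_pow x (m - 1))"

definition diag_entry :: "nat \<Rightarrow> 'n::finite tensor \<Rightarrow> 'n \<Rightarrow> real" where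
  "diag_entry m A i = A (replicate m i)"

definition offdiag :: "nat \<Rightarrow> 'n::finite \<Rightarrow> 'n list set" where
  "offdiag m i = tuples (m - 1) - {replicate (m - 1) i}"

definition r_plus :: "nat \<Rightarrow> 'n::finite tensor \<Rightarrow> 'n \<Rightarrow> real" where
  "r_plus m A i = Max (insert 0 ((\<lambda>js. A (i # js)) ` offdiag m i))"

definition r_minus :: "nat \<Rightarrow> 'n::finite tensor \<Rightarrow> 'n \<Rightarrow> real" where
  "r_minus m A i = Min (insert 0 ((\<lambda>js. A (i # js)) ` offdiag m i))"

end

theory Submission
  imports Defs
begin

text \<open>
  Let \<open>E\<close> be the tensor whose entry at a tuple is the least \<open>r\<^sup>+\<close> of its indices. Its form is a
  nonnegative combination of even powers \<open>(\<Sum>i\<in>J. x\<^sub>i)\<^sup>m\<close> over the superlevel sets \<open>J\<close> of \<open>r\<^sup>+\<close>, hence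
  nonnegative. By symmetry \<open>C = A - E\<close> has nonpositive off-diagonal entries, and its \<open>i\<close>-th row sum
  is at least the \<open>i\<close>-th left end point; by AM-GM and symmetry the form of \<open>C\<close> is at least the sum
  of its row sums weighted with \<open>x\<^sub>i\<^sup>m\<close>. For an eigenvector \<open>x\<close> the form of \<open>A\<close> is
  \<open>l * (\<Sum>i. x\<^sub>i\<^sup>m)\<close>, so \<open>l\<close> cannot be less than all left end points. The right end points
  follow by passing to \<open>-A\<close>.
\<close>

section \<open>Sums over index tuples\<close>

lemma tuples_0: "tuples 0 = {[]}"
  by (simp add: tuples_def)

lemma sum_tuples_Suc:
  fixes f :: "'n::finite list \<Rightarrow> 'b::comm_monoid_add"
  shows "(\<Sum>js\<in>tuples (Suc k). f js) = (\<Sum>i\<in>UNIV. \<Sum>js\<in>tuples k. f (i # js))"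
proof -
  have "(tuples (Suc k) :: 'n list set) = (\<lambda>x. fst x # snd x) ` (UNIV \<times> tuples k)"
    by (force simp: tuples_def length_Suc_conv)
  moreover have "inj_on (\<lambda>x. fst x # snd x) (UNIV \<times> (tuples k :: 'n list set))"
    by (auto simp: inj_on_def)
  ultimately show ?thesis
    by (simp add: sum.reindex sum.cartesian_product case_prod_unfold)
qed

lemma sum_tuples_prod:
  fixes f :: "'n::finite \<Rightarrow> real"
  shows "(\<Sum>js\<in>tuples m. \<Prod>j\<leftarrow>js. f j) = (\<Sum>i\<in>UNIV. f i) ^ m"
proof (induction m)
  case (Suc m)
  have "(\<Sum>js\<in>tuples (Suc m). \<Prod>j\<leftarrow>js. f j)
      = (\<Sum>i\<in>UNIV. f i * (\<Sum>js\<in>tuples m. \<Prod>j\<leftarrow>js. f j))"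
    by (simp add: sum_tuples_Suc sum_distrib_left)
  then show ?case by (simp add: Suc.IH flip: sum_distrib_right)
qed (simp add: tuples_0)

section \<open>Nonnegativity of the form with minimum entries\<close>

lemma prod_list_if_mem:
  fixes f :: "'a \<Rightarrow> real"
  shows "(\<Prod>j\<leftarrow>js. if j \<in> J then f j else 0) = (if set js \<subseteq> J then \<Prod>j\<leftarrow>js. f j else 0)"
  by (induction js) auto

lemma prod_list_conv_prod_nth: "(\<Prod>j\<leftarrow>js. f j) = (\<Prod>k<length js. f (js ! k))"
  by (simp add: prod.list_conv_set_nth atLeast0LessThan)

text \<open>Induction on the size of the support \<open>J\<close> of \<open>r\<close>: lowering
  \<open>r\<close> on \<open>J\<close> by its least positive value \<open>h\<close> removes exactly
  \<open>h * (\<Sum>i\<in>J. x i) ^ m\<close> from the form, which is nonnegative for even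
  \<open>m\<close>.\<close>

lemma min_form_nonneg:
  fixes r x :: "'n::finite \<Rightarrow> real"
  assumes "even m" "0 < m" "\<And>i. 0 \<le> r i"
  shows "0 \<le> (\<Sum>js\<in>tuples m. Min (r ` set js) * (\<Prod>j\<leftarrow>js. x j))"
  using assms(3)
proof (induction "card {i. 0 < r i}" arbitrary: r rule: less_induct)
  case less
  define J where "J = {i. 0 < r i}"
  \<comment> \<open>Ensures that \<open>Min\<close> is never taken over the empty set.\<close>
  have ne: "js \<noteq> []" if "js \<in> tuples m" for js :: "'n list"
    using that \<open>0 < m\<close> by (auto simp: tuples_def)
  show ?case
  proof (cases "J = {}")
    case True
    then have r0: "r i = 0" for i
      using less.prems[of i] by (auto simp: J_def intro: antisym simp flip: not_less)
    have "Min (r ` set js) = 0" if "js \<in> tuples m" for js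
    proof -
      have "r ` set js = {0}" using ne[OF that] r0 by (cases js) auto
      then show ?thesis by simp
    qed
    then show ?thesis by simp
  next
    case False
    define h where "h = Min (r ` J)"
    define r' where "r' i = (if i \<in> J then r i - h else r i)" for i
    have h_le: "h \<le> r i" if "i \<in> J" for i
      using that by (simp add: h_def)
    have "h \<in> r ` J"
      unfolding h_def using False by (intro Min_in) auto
    then obtain i0 where i0: "i0 \<in> J" "r i0 = h" by auto
    have h_pos: "0 < h" using i0 by (auto simp: J_def)
    have r'_nonneg: "0 \<le> r' i" for i
      using h_le less.prems by (simp add: r'_def)
    \<comment> \<open>The minimizer \<open>i0\<close> leaves the support, so the induction measure
      drops.\<close>
    have "{i. 0 < r' i} \<subset> J"
      using i0 by (auto simp: r'_def J_def split: if_splits)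
    then have "card {i. 0 < r' i} < card {i. 0 < r i}"
      unfolding J_def by (intro psubset_card_mono) auto
    then have IH: "0 \<le> (\<Sum>js\<in>tuples m. Min (r' ` set js) * (\<Prod>j\<leftarrow>js. x j))"
      using less.hyps r'_nonneg by blast
    \<comment> \<open>Inside \<open>J\<close> all values shift by \<open>h\<close>; an index outside
      \<open>J\<close> forces both minima to be 0.\<close>
    have split: "Min (r ` set js) = Min (r' ` set js) + (if set js \<subseteq> J then h else 0)"
      if "js \<in> tuples m" for js
    proof (cases "set js \<subseteq> J")
      case True
      have "r ` set js = (\<lambda>y. y + h) ` (r' ` set js)"
        using True by (force simp: r'_def image_image)
      then have "Min (r ` set js) = Min (r' ` set js) + h"
        using ne[OF that] by (simp add: Min_add_commute[of "set js" r' h, symmetric] image_image)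
      then show ?thesis using True by simp
    next
      case False
      then obtain j where j: "j \<in> set js" "j \<notin> J" by auto
      then have "r j = 0" "r' j = 0"
        using less.prems[of j] by (auto simp: J_def r'_def)
      then have "Min (r ` set js) = 0" "Min (r' ` set js) = 0"
        using j less.prems r'_nonneg by (force intro!: Min_eqI)+
      then show ?thesis using False by simp
    qed
    \<comment> \<open>Setting \<open>x\<close> to zero outside \<open>J\<close> selects the tuples
      inside \<open>J\<close>, so that their sum factors as an \<open>m\<close>-th power.\<close>
    have "(\<Sum>js\<in>tuples m. Min (r ` set js) * (\<Prod>j\<leftarrow>js. x j)) =
        (\<Sum>js\<in>tuples m. Min (r' ` set js) * (\<Prod>j\<leftarrow>js. x j)
          + h * (\<Prod>j\<leftarrow>js. if j \<in> J then x j else 0))"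
      by (rule sum.cong) (auto simp: split prod_list_if_mem distrib_right)
    also have "\<dots> = (\<Sum>js\<in>tuples m. Min (r' ` set js) * (\<Prod>j\<leftarrow>js. x j))
        + h * (\<Sum>i\<in>UNIV. if i \<in> J then x i else 0) ^ m"
      by (simp add: sum.distrib sum_tuples_prod flip: sum_distrib_left)
    also have "0 \<le> \<dots>"
      using IH h_pos \<open>even m\<close> by (simp add: zero_le_even_power)
    finally show ?thesis .
  qed
qed

section \<open>Symmetry, AM-GM and row sums\<close>

lemma tuples_permute_list [simp]: "permute_list p js \<in> tuples m \<longleftrightarrow> js \<in> tuples m"
  by (simp add: tuples_def)

text \<open>Swapping positions 0 and \<open>k\<close> is an involution on tuples that leaves
  \<open>C\<close> unchanged, so it reindexes one sum into the other.\<close>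

lemma sum_tuples_nth_symmetric:
  fixes C :: "'n::finite tensor"
  assumes "symmetric_tensor m C" "k < m"
  shows "(\<Sum>js\<in>tuples m. C js * y (js ! k)) = (\<Sum>js\<in>tuples m. C js * y (js ! 0))"
proof -
  define p where "p = Transposition.transpose 0 k"
  have p: "p permutes {..<m}"
    unfolding p_def using assms(2) by (intro permutes_swap_id) auto
  have pp: "permute_list p (permute_list p js) = js" if "js \<in> tuples m" for js :: "'n list"
  proof -
    have "permute_list (p \<circ> p) js = permute_list p (permute_list p js)"
      using that p by (intro permute_list_compose) (auto simp: tuples_def)
    then show ?thesis by (simp add: p_def)
  qed
  have nth: "permute_list p js ! 0 = js ! k" if "js \<in> tuples m" for js :: "'n list"
    using that assms(2) by (subst permute_list_nth) (use p in \<open>auto simp: tuples_def p_def\<close>)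
  show ?thesis
    by (rule sum.reindex_bij_witness[where i = "permute_list p" and j = "permute_list p"])
      (use assms(1) p pp nth in \<open>auto simp: symmetric_tensor_def\<close>)
qed

text \<open>AM-GM for the powers \<open>a k ^ card S\<close>, whose geometric mean is the product of
  the \<open>a k\<close>.\<close>

lemma prod_le_mean_power:
  fixes a :: "'a \<Rightarrow> real"
  assumes "finite S" "S \<noteq> {}" "\<And>k. k \<in> S \<Longrightarrow> 0 \<le> a k"
  shows "(\<Prod>k\<in>S. a k) \<le> (\<Sum>k\<in>S. a k ^ card S) / card S"
proof -
  have "0 < card S" using assms(1,2) by (simp add: card_gt_0_iff)
  moreover have "0 \<le> (\<Prod>k\<in>S. a k)" using assms(3) by (simp add: prod_nonneg)
  ultimately have "((\<Prod>k\<in>S. a k) ^ card S) powr (1 / card S) = (\<Prod>k\<in>S. a k)"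
    by (simp add: real_root_power_cancel flip: root_powr_inverse)
  then show ?thesis
    using arith_geom_mean[OF assms(1,2), of "\<lambda>k. a k ^ card S"] assms(3)
    by (simp add: prod_power_distrib sum_divide_distrib)
qed

lemma abs_prod_list_le_mean_power:
  fixes x :: "'a \<Rightarrow> real"
  assumes "even m" "0 < m" "length js = m"
  shows "\<bar>\<Prod>j\<leftarrow>js. x j\<bar> \<le> (\<Sum>k<m. x (js ! k) ^ m) / m"
  using prod_le_mean_power[of "{..<m}" "\<lambda>k. \<bar>x (js ! k)\<bar>"] assms
  by (auto simp: prod_list_conv_prod_nth abs_prod power_even_abs lessThan_empty_iff)

text \<open>The weighted row sums are the sum of \<open>C js * x (js ! 0) ^ m\<close>. Symmetry
  allows averaging the power over all positions, and the comparison is then termwise: AM-GM,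
  reversed by the sign of \<open>C js\<close>, off the diagonal and equality on it.\<close>

lemma form_ge_row_sums:
  fixes C :: "'n::finite tensor" and x :: "'n \<Rightarrow> real"
  assumes "even m" "0 < m" "symmetric_tensor m C"
    and offdiag: "\<And>js. js \<in> tuples m \<Longrightarrow> (\<forall>i. js \<noteq> replicate m i) \<Longrightarrow> C js \<le> 0"
  shows "(\<Sum>i\<in>UNIV. (\<Sum>js\<in>tuples (m - 1). C (i # js)) * x i ^ m)
    \<le> (\<Sum>js\<in>tuples m. C js * (\<Prod>j\<leftarrow>js. x j))"
proof -
  obtain k where m: "m = Suc k" using assms(2) by (cases m) auto
  have "(\<Sum>js\<in>tuples m. C js * x (js ! 0) ^ m)
      = (\<Sum>l<m. \<Sum>js\<in>tuples m. C js * x (js ! l) ^ m) / m"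
  proof -
    have "(\<Sum>l<m. \<Sum>js\<in>tuples m. C js * x (js ! l) ^ m)
        = (\<Sum>l<m. \<Sum>js\<in>tuples m. C js * x (js ! 0) ^ m)"
      by (intro sum.cong refl sum_tuples_nth_symmetric[OF assms(3), where y = "\<lambda>i. x i ^ m"]) simp
    then show ?thesis using assms(2) by simp
  qed
  also have "\<dots> = (\<Sum>js\<in>tuples m. C js * ((\<Sum>l<m. x (js ! l) ^ m) / m))"
    by (subst sum.swap) (simp add: sum_divide_distrib sum_distrib_left)
  also have "\<dots> \<le> (\<Sum>js\<in>tuples m. C js * (\<Prod>j\<leftarrow>js. x j))"
  proof (rule sum_mono)
    fix js :: "'n list" assume js: "js \<in> tuples m"
    show "C js * ((\<Sum>l<m. x (js ! l) ^ m) / m) \<le> C js * (\<Prod>j\<leftarrow>js. x j)"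
    proof (cases "\<exists>i. js = replicate m i")
      case True
      then show ?thesis using assms(2) by (auto simp: prod_list_replicate)
    next
      case False
      then have "C js \<le> 0" using offdiag js by blast
      then show ?thesis
        using abs_prod_list_le_mean_power[OF assms(1,2), of js x] js
        by (intro mult_left_mono_neg) (auto simp: tuples_def)
    qed
  qed
  also have "(\<Sum>js\<in>tuples m. C js * x (js ! 0) ^ m)
      = (\<Sum>i\<in>UNIV. (\<Sum>js\<in>tuples (m - 1). C (i # js)) * x i ^ m)"
    by (simp add: m sum_tuples_Suc sum_distrib_right)
  finally show ?thesis .
qed

section \<open>Lower bounds from the left end points\<close>

lemma r_plus_nonneg: "0 \<le> r_plus m A i"
  unfolding r_plus_def by (rule Max_ge) (auto simp: offdiag_def finite_tuples)

text \<open>\<open>r_plus m A i\<close> only sees entries with first index \<open>i\<close>;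
  symmetry moves any occurrence of \<open>i\<close> to the front. Hence an off-diagonal entry is at
  most the least \<open>r_plus\<close> of its indices.\<close>

lemma symmetric_entry_le_r_plus:
  fixes A :: "'n::finite tensor"
  assumes "symmetric_tensor m A" "js \<in> tuples m" "\<forall>i. js \<noteq> replicate m i" "i \<in> set js"
  shows "A js \<le> r_plus m A i"
proof -
  obtain k where k: "k < m" "js ! k = i"
    using assms(2,4) by (auto simp: in_set_conv_nth tuples_def)
  define p where "p = Transposition.transpose 0 k"
  have p: "p permutes {..<m}"
    unfolding p_def using k by (intro permutes_swap_id) auto
  define ks where "ks = permute_list p js"
  have len: "length ks = m" "length js = m"
    using assms(2) by (auto simp: ks_def tuples_def)
  have "ks ! 0 = i"
    unfolding ks_def using k p len by (subst permute_list_nth) (auto simp: p_def)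
  then have ks: "ks = i # tl ks" using len k by (cases ks) auto
  have "set ks = set js" unfolding ks_def using p len by (intro set_permute_list) auto
  then have "ks \<noteq> replicate m i"
    using assms(3) len k by (metis empty_iff insert_iff replicate_eqI set_replicate_conv_if)
  then have "tl ks \<in> offdiag m i"
    using ks len k by (cases m) (auto simp: offdiag_def tuples_def)
  then have "A (i # tl ks) \<le> r_plus m A i"
    unfolding r_plus_def by (intro Max_ge) (auto simp: offdiag_def finite_tuples)
  moreover have "A ks = A js"
    using assms(1,2) p by (simp add: ks_def symmetric_tensor_def)
  ultimately show ?thesis using ks by simp
qed

definition lower_end :: "nat \<Rightarrow> 'n::finite tensor \<Rightarrow> 'n \<Rightarrow> real" where
  "lower_end m A i =
     diag_entry m A i - r_plus m A i - (\<Sum>js\<in>offdiag m i. r_plus m A i - A (i # js))"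

text \<open>The diagonal tuple contributes \<open>diag_entry m A i - r_plus m A i\<close>, which
  completes the off-diagonal sum to a full row sum.\<close>

lemma lower_end_eq_sum:
  assumes "0 < m"
  shows "lower_end m A i = (\<Sum>js\<in>tuples (m - 1). A (i # js) - r_plus m A i)"
proof -
  have "replicate (m - 1) i \<in> tuples (m - 1)" by (simp add: tuples_def)
  moreover have "i # replicate (m - 1) i = replicate m i" using assms by (cases m) auto
  ultimately show ?thesis
    unfolding lower_end_def offdiag_def diag_entry_def
    by (subst sum.remove[OF finite_tuples, of "replicate (m - 1) i"]) (auto simp: sum_subtractf)
qed

lemma form_ge_lower_ends:
  fixes A :: "'n::finite tensor" and x :: "'n \<Rightarrow> real"
  assumes "even m" "0 < m" "symmetric_tensor m A"
  shows "(\<Sum>i\<in>UNIV. lower_end m A i * x i ^ m) \<le> (\<Sum>js\<in>tuples m. A js * (\<Prod>j\<leftarrow>js. x j))"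
proof -
  define r where "r = r_plus m A"
  define C where "C js = A js - Min (r ` set js)" for js
  \<comment> \<open>The subtracted minimum depends only on \<open>set js\<close>, which permutations
    preserve.\<close>
  have "symmetric_tensor m C"
    using assms(3) by (auto simp: symmetric_tensor_def C_def tuples_def)
  moreover have "C js \<le> 0" if "js \<in> tuples m" "\<forall>i. js \<noteq> replicate m i" for js
  proof -
    have "set js \<noteq> {}" using that assms(2) by (auto simp: tuples_def)
    then show ?thesis
      using symmetric_entry_le_r_plus[OF assms(3) that] by (simp add: C_def r_def)
  qed
  ultimately have C: "(\<Sum>i\<in>UNIV. (\<Sum>js\<in>tuples (m - 1). C (i # js)) * x i ^ m)
      \<le> (\<Sum>js\<in>tuples m. C js * (\<Prod>j\<leftarrow>js. x j))"
    using assms(1,2) by (intro form_ge_row_sums) auto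
  \<comment> \<open>The index \<open>i\<close> occurs in \<open>i # js\<close>, so the subtracted
    minimum is at most \<open>r i\<close>.\<close>
  have "lower_end m A i \<le> (\<Sum>js\<in>tuples (m - 1). C (i # js))" for i
    unfolding lower_end_eq_sum[OF assms(2)] C_def r_def
    by (intro sum_mono diff_left_mono Min_le) auto
  then have "(\<Sum>i\<in>UNIV. lower_end m A i * x i ^ m)
      \<le> (\<Sum>i\<in>UNIV. (\<Sum>js\<in>tuples (m - 1). C (i # js)) * x i ^ m)"
    using assms(1) by (intro sum_mono mult_right_mono) (auto simp: zero_le_even_power)
  also note C
  also have "(\<Sum>js\<in>tuples m. C js * (\<Prod>j\<leftarrow>js. x j))
      \<le> (\<Sum>js\<in>tuples m. C js * (\<Prod>j\<leftarrow>js. x j))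
        + (\<Sum>js\<in>tuples m. Min (r ` set js) * (\<Prod>j\<leftarrow>js. x j))"
    using min_form_nonneg[OF assms(1,2), of r x] r_plus_nonneg by (auto simp: r_def)
  also have "\<dots> = (\<Sum>js\<in>tuples m. A js * (\<Prod>j\<leftarrow>js. x j))"
    by (simp add: C_def left_diff_distrib flip: sum.distrib)
  finally show ?thesis .
qed

lemma H_eigenvalue_ge_lower_end:
  fixes A :: "'n::finite tensor"
  assumes "even m" "0 < m" "symmetric_tensor m A" "H_eigenvalue m A l"
  shows "\<exists>i. lower_end m A i \<le> l"
proof (rule ccontr)
  assume "\<not> ?thesis"
  then have less: "l < lower_end m A i" for i by (simp add: not_le)
  obtain k where m: "m = Suc k" using assms(2) by (cases m) auto
  obtain x where x: "x \<noteq> 0" "tensor_apply m A x = l *\<^sub>R vec_pow x k"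
    using assms(4) m by (auto simp: H_eigenvalue_def)
  then obtain i0 where i0: "x $ i0 \<noteq> 0" by (auto simp: vec_eq_iff)
  have row: "(\<Sum>js\<in>tuples k. A (i # js) * (\<Prod>j\<leftarrow>js. x $ j)) = l * (x $ i) ^ k" for i
    using arg_cong[OF x(2), of "\<lambda>v. v $ i"] by (simp add: tensor_apply_def vec_pow_def m)
  \<comment> \<open>Splitting off the first index makes the form the inner product of
    \<open>x\<close> with \<open>tensor_apply m A x\<close>.\<close>
  have "(\<Sum>js\<in>tuples m. A js * (\<Prod>j\<leftarrow>js. x $ j))
      = (\<Sum>i\<in>UNIV. x $ i * (\<Sum>js\<in>tuples k. A (i # js) * (\<Prod>j\<leftarrow>js. x $ j)))"
    by (simp add: m sum_tuples_Suc sum_distrib_left mult_ac)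
  also have "\<dots> = (\<Sum>i\<in>UNIV. l * (x $ i) ^ m)"
    by (simp add: row m mult_ac)
  \<comment> \<open>Even powers are nonnegative weights, and the one at \<open>i0\<close> is
    positive, which gives strictness.\<close>
  also have "\<dots> < (\<Sum>i\<in>UNIV. lower_end m A i * (x $ i) ^ m)"
  proof (rule sum_strict_mono_ex1)
    show "\<forall>i\<in>UNIV. l * (x $ i) ^ m \<le> lower_end m A i * (x $ i) ^ m"
      using assms(1)
      by (intro ballI mult_right_mono less_imp_le[OF less]) (simp add: zero_le_even_power)
    have "0 < (x $ i0) ^ m" using i0 assms(1) by (simp add: zero_less_power_eq)
    then show "\<exists>i\<in>UNIV. l * (x $ i) ^ m < lower_end m A i * (x $ i) ^ m"
      using mult_strict_right_mono[OF less] by blast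
  qed simp
  finally show False
    using form_ge_lower_ends[OF assms(1-3), of "\<lambda>i. x $ i"] by simp
qed

section \<open>Right end points by negation\<close>

lemma r_plus_uminus: "r_plus m (\<lambda>js. - A js) i = - r_minus m A i"
proof -
  let ?S = "insert 0 ((\<lambda>js. A (i # js)) ` offdiag m i)"
  have "Max (uminus ` ?S) = - Min ?S"
    by (subst minus_Min_eq_Max) (auto simp: offdiag_def finite_tuples)
  then show ?thesis by (simp add: r_plus_def r_minus_def image_image)
qed

lemma lower_end_uminus:
  "lower_end m (\<lambda>js. - A js) i =
    - (diag_entry m A i - r_minus m A i + (\<Sum>js\<in>offdiag m i. A (i # js) - r_minus m A i))"
  by (simp add: lower_end_def r_plus_uminus diag_entry_def)

lemma H_eigenvalue_uminus:
  assumes "H_eigenvalue m A l"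
  shows "H_eigenvalue m (\<lambda>js. - A js) (- l)"
proof -
  have "tensor_apply m (\<lambda>js. - A js) x = - tensor_apply m A x" for x
    by (simp add: tensor_apply_def vec_eq_iff sum_negf)
  then show ?thesis using assms by (auto simp: H_eigenvalue_def)
qed

theorem theorem6:
  fixes m :: nat and A :: "'n::finite tensor" and l :: real
  assumes "2 \<le> m" and "even m"
    and "symmetric_tensor m A"
    and "H_eigenvalue m A l"
  shows "l \<in> (\<Union>i. \<Union>j.
    {diag_entry m A i - r_plus m A i - (\<Sum>js\<in>offdiag m i. r_plus m A i - A (i # js)) ..
     diag_entry m A j - r_minus m A j + (\<Sum>js\<in>offdiag m j. A (j # js) - r_minus m A j)})"
proof -
  have m: "0 < m" using assms(1) by simp
  obtain i where i: "lower_end m A i \<le> l"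
    using H_eigenvalue_ge_lower_end[OF assms(2) m assms(3,4)] by blast
  have "symmetric_tensor m (\<lambda>js. - A js)"
    using assms(3) by (simp add: symmetric_tensor_def)
  then obtain j where j: "lower_end m (\<lambda>js. - A js) j \<le> - l"
    using H_eigenvalue_ge_lower_end[OF assms(2) m _ H_eigenvalue_uminus[OF assms(4)]] by blast
  show ?thesis
    using i[unfolded lower_end_def] j[unfolded lower_end_uminus neg_le_iff_le]
    by (intro UN_I[of i] UN_I[of j]) auto
qed

end
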